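(* Let $\pi$ be a target density on $\Theta\subset\mathbb{R}^d$, let $(\pi^{(\ell)})_{\ell\ge 1}$ be approximating densities converging pointwise to $\pi$, and let $\mu_0$ be an initial distribution. Assume the following. (i) The costs $c_\ell$ of integrating the mean-field SVGD equation with target density $\pi^{(\ell)}$ for a unit time interval are bounded as $c_\ell\le c_0 s^{\gamma\ell}$ for all $\ell\in\mathbb{N}$, with constants $c_0,\gamma>0$ independent of $\ell$ and $s>1$. (ii) There exist $\alpha,k_0,k_1>0$ independent of $\ell$ such that $\mathrm{KL}(\mu_0\,\|\,\pi^{(\ell)})\le k_0$ and $\mathrm{KL}(\pi^{(\ell)}\,\|\,\pi)\le k_1 s^{-\alpha\ell}$ for all $\ell\in\mathbb{N}$, with the same $s$ as in (i). (iii) There exists a constant $k_2>0$ independent of $\ell$ such that $\mathrm{KL}(\pi^{(\ell-1)}\,\|\,\pi^{(\ell)})\le k_2s^{-\alpha\ell}$ for $\ell\ge2$, with the same $\alpha$ as in (ii). (iv) There exists a decreasing function $r:[0,\infty)\to[0,1]$ with $r(0)=1$ and $\lim_{t\to\infty}r(t)=0$ such that, for all levels $\ell\in\mathbb{N}$ and all initial distributions $\nu_0$, $$\mathrm{KL}(\nu_t\,\|\,\pi^{(\ell)})\le r(t)\,\mathrm{KL}(\nu_0\,\|\,\pi^{(\ell)}),$$ where $\nu_t$ is the solution at time $t$ of the mean-field SVGD equation with target $\pi^{(\ell)}$ and initial distribution $\nu_0$. (v) $R_\ell\le k_3s^{-\alpha\ell}$ for $\ell\ge2$, with a constant $k_3$,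 where $$R_\ell=\int_{\mathbb{R}^d}\Big(\mu^{(\ell-1)}_{T_{\ell-1}}(\theta)-\pi^{(\ell-1)}(\theta)\Big)\log\!\left(\frac{\pi^{(\ell-1)}(\theta)}{\pi^{(\ell)}(\theta)}\right)\mathrm{d}\theta$$ and $\mu^{(\ell)}_{T_\ell}$ are the multilevel SVGD densities defined in the context. Then, by setting $\epsilon_\ell=\sqrt{2k_1}\,s^{-\alpha\ell/2}$ for $\ell=1,\dots,L$, the cost $c_{\mathrm{ML}}(\epsilon)$ of multilevel SVGD to have $\mathrm{d}_{\mathrm{Hell}}(\mu^{\mathrm{ML}},\pi)\le\epsilon$ can be bounded as $$c_{\mathrm{ML}}(\epsilon)\le\frac{c_0s^{2\gamma}(2k_1)^{\gamma/\alpha}}{s^\gamma-1}\; r^{-1}\!\left(\frac{1}{s^\alpha+(k_2+k_3)/k_1}\right)\epsilon^{-2\gamma/\alpha}.$$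
   Context: $\mathrm{KL}(\mu\,\|\,\nu)$ is the Kullback–Leibler divergence, and $\mathrm{d}_{\mathrm{Hell}}$ is the Hellinger distance, normalized so that $2\,\mathrm{d}_{\mathrm{Hell}}(\mu_1,\mu_2)^2\le\mathrm{KL}(\mu_1\,\|\,\mu_2)$. Mean-field SVGD (Stein variational gradient descent) equation: fix a positive definite kernel $K:\Theta\times\Theta\to\mathbb{R}$. For a target density $p$ and initial distribution $\nu_0$, the equation is $$\partial_t\nu_t(\theta)=-\nabla\cdot\Big(\nu_t(\theta)\,\mathbb{E}_{z\sim\nu_t}\big[K(z,\theta)\nabla\log p(z)+\nabla_1K(z,\theta)\big]\Big),$$ where $\nabla_1$ is the gradient with respect to the first argument. Multilevel SVGD: given a tolerance $\epsilon>0$, a high-fidelity level $L=L(\epsilon)$ is selected such that $\mathrm{d}_{\mathrm{Hell}}(\pi^{(L)},\pi)\le\epsilon/2$, and tolerances $\epsilon_1\ge\dots\ge\epsilon_L$ with $\epsilon_L\le\epsilon$ are given. Starting from $\mu_0$ at level $1$, for $\ell=1,\dots,L$ let $\mu^{(\ell)}_t$ be the solution of the mean-field SVGD equation with target $\pi^{(\ell)}$ whose initial density is the density $\mu^{(\ell-1)}_{T_{\ell-1}}$ obtained at the previous level (and $\mu_0$ for $\ell=1$), with $$T_\ell=\min\{t\ge0:\ \mathrm{KL}(\mu^{(\ell)}_t\,\|\,\pi^{(\ell)})\le \epsilon_\ell^2/2\}.$$ The multilevel approximation is $\mu^{\mathrm{ML}}=\mu^{(L)}_{T_L}$ and its cost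 is $c_{\mathrm{ML}}(\epsilon)=\sum_{\ell=1}^{L}c_\ell T_\ell$. If $r$ is not invertible due to a discontinuity, $r^{-1}$ is defined by $r^{-1}(x)=\min\{t\in[0,\infty):\ r(t)\le x\}$.
   Formalization: Two conditions are added, as the claim fails without them: k_0 ≤ k_1+(k_2+k_3)s^{-α} (always attainable by enlarging k_2) and ε ≤ √(2k_1). L is the least level with d_Hell(π^(L),π) ≤ ε/2 and ε_L ≤ ε; solutions are classical; R_ℓ is assumed to exist. *)

theory Defs
  imports "HOL-Probability.Probability"
begin

definition prob_density_on :: "'a::euclidean_space set \<Rightarrow> ('a \<Rightarrow> real) \<Rightarrow> bool" where
  "prob_density_on \<Theta> p \<longleftrightarrow>
     p \<in> borel_measurable borel \<and> (\<forall>x. 0 \<le> p x) \<and> (\<forall>x. x \<notin> \<Theta> \<longrightarrow> p x = 0) \<and>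
     prob_space (density lborel p)"

text \<open>The library's \<^const>\<open>KL_divergence\<close> is a real-valued Bochner integral, with the reference
  measure as its first measure argument. Where it does not represent the divergence
  (no absolute continuity, or a non-integrable log-likelihood ratio), the divergence is infinite.\<close>

definition KL :: "('a::euclidean_space \<Rightarrow> real) \<Rightarrow> ('a \<Rightarrow> real) \<Rightarrow> ereal" where
  "KL p q =
     (if absolutely_continuous (density lborel q) (density lborel p) \<and>
         integrable (density lborel p)
           (entropy_density (exp 1) (density lborel q) (density lborel p))
      then ereal (KL_divergence (exp 1) (density lborel q) (density lborel p))
      else \<infinity>)"

text \<open>The factor \<open>1/2\<close> is the normalization for which \<open>2 * (hellinger p q)\<^sup>2 \<le> KL p q\<close>.\<close>

definition hellinger :: "('a::euclidean_space \<Rightarrow> real) \<Rightarrow> ('a \<Rightarrow> real) \<Rightarrow> real" where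
  "hellinger p q = sqrt (1 / 2 * (\<integral>x. (sqrt (p x) - sqrt (q x))\<^sup>2 \<partial>lborel))"

definition positive_definite_kernel :: "'a set \<Rightarrow> ('a \<Rightarrow> 'a \<Rightarrow> real) \<Rightarrow> bool" where
  "positive_definite_kernel \<Theta> K \<longleftrightarrow>
     (\<forall>x\<in>\<Theta>. \<forall>y\<in>\<Theta>. K x y = K y x) \<and>
     (\<forall>X c. finite X \<and> X \<subseteq> \<Theta> \<longrightarrow> 0 \<le> (\<Sum>x\<in>X. \<Sum>y\<in>X. c x * c y * K x y))"

definition gradient :: "('a::euclidean_space \<Rightarrow> real) \<Rightarrow> 'a \<Rightarrow> 'a" where
  "gradient f x = (THE D. GDERIV f x :> D)"

definition divergence :: "('a::euclidean_space \<Rightarrow> 'a) \<Rightarrow> 'a \<Rightarrow> real" where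
  "divergence F x = (\<Sum>b\<in>Basis. frechet_derivative F (at x) b \<bullet> b)"

definition svgd_integrand ::
  "('a::euclidean_space \<Rightarrow> 'a \<Rightarrow> real) \<Rightarrow> ('a \<Rightarrow> real) \<Rightarrow> 'a \<Rightarrow> 'a \<Rightarrow> 'a" where
  "svgd_integrand K p \<theta> z =
     K z \<theta> *\<^sub>R gradient (\<lambda>y. ln (p y)) z + gradient (\<lambda>y. K y \<theta>) z"

definition svgd_flux ::
  "'a::euclidean_space set \<Rightarrow> ('a \<Rightarrow> 'a \<Rightarrow> real) \<Rightarrow> ('a \<Rightarrow> real) \<Rightarrow> ('a \<Rightarrow> real) \<Rightarrow> 'a \<Rightarrow> 'a" where
  "svgd_flux \<Theta> K p q \<theta> = q \<theta> *\<^sub>R (LINT z:\<Theta>|density lborel q. svgd_integrand K p \<theta> z)"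

text \<open>Classical solutions of the mean-field SVGD equation with target \<open>p\<close> on the open set \<open>\<Theta>\<close>;
  the initial density is \<open>\<nu> 0\<close>. The kernel gradient is only required almost everywhere, because it
  enters only through an integral over \<open>z\<close>; this admits kernels with a kink on the diagonal.\<close>

definition svgd_solution ::
  "'a::euclidean_space set \<Rightarrow> ('a \<Rightarrow> 'a \<Rightarrow> real) \<Rightarrow> ('a \<Rightarrow> real) \<Rightarrow> (real \<Rightarrow> 'a \<Rightarrow> real) \<Rightarrow> bool" where
  "svgd_solution \<Theta> K p \<nu> \<longleftrightarrow>
     (\<forall>\<theta>\<in>\<Theta>. 0 < p \<theta> \<and> (\<lambda>y. ln (p y)) differentiable (at \<theta>)) \<and>
     (\<forall>\<theta>\<in>\<Theta>. AE z in lborel. z \<in> \<Theta> \<longrightarrow> (\<lambda>y. K y \<theta>) differentiable (at z)) \<and>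
     (\<forall>t\<ge>0. prob_density_on \<Theta> (\<nu> t)) \<and>
     (\<forall>\<theta>\<in>\<Theta>. continuous_on {0..} (\<lambda>t. \<nu> t \<theta>)) \<and>
     (\<forall>t>0. \<forall>\<theta>\<in>\<Theta>.
        set_integrable (density lborel (\<nu> t)) \<Theta> (svgd_integrand K p \<theta>) \<and>
        svgd_flux \<Theta> K p (\<nu> t) differentiable (at \<theta>) \<and>
        ((\<lambda>\<tau>. \<nu> \<tau> \<theta>) has_real_derivative - divergence (svgd_flux \<Theta> K p (\<nu> t)) \<theta>) (at t))"

definition svgd_stop_time ::
  "('a::euclidean_space \<Rightarrow> real) \<Rightarrow> (real \<Rightarrow> 'a \<Rightarrow> real) \<Rightarrow> real \<Rightarrow> real" where
  "svgd_stop_time p \<nu> e = (LEAST t. 0 \<le> t \<and> KL (\<nu> t) p \<le> ereal (e\<^sup>2 / 2))"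

definition ml_stop_time ::
  "(nat \<Rightarrow> 'a::euclidean_space \<Rightarrow> real) \<Rightarrow> (nat \<Rightarrow> real) \<Rightarrow> (nat \<Rightarrow> real \<Rightarrow> 'a \<Rightarrow> real) \<Rightarrow> nat \<Rightarrow> real" where
  "ml_stop_time p tol \<mu> l = svgd_stop_time (p l) (\<mu> l) (tol l)"

definition ml_density ::
  "(nat \<Rightarrow> 'a::euclidean_space \<Rightarrow> real) \<Rightarrow> (nat \<Rightarrow> real) \<Rightarrow> (nat \<Rightarrow> real \<Rightarrow> 'a \<Rightarrow> real) \<Rightarrow> nat \<Rightarrow> 'a \<Rightarrow> real" where
  "ml_density p tol \<mu> l = \<mu> l (ml_stop_time p tol \<mu> l)"

text \<open>Levels start at 1; values at level 0 are irrelevant. The trajectories at levels up to \<open>L\<close> do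
  not depend on \<open>L\<close>, so one infinite hierarchy serves all accuracies.\<close>

definition multilevel_svgd ::
  "'a::euclidean_space set \<Rightarrow> ('a \<Rightarrow> 'a \<Rightarrow> real) \<Rightarrow> (nat \<Rightarrow> 'a \<Rightarrow> real) \<Rightarrow> (nat \<Rightarrow> real) \<Rightarrow>
   ('a \<Rightarrow> real) \<Rightarrow> (nat \<Rightarrow> real \<Rightarrow> 'a \<Rightarrow> real) \<Rightarrow> bool" where
  "multilevel_svgd \<Theta> K p tol \<mu>0 \<mu> \<longleftrightarrow>
     (\<forall>l\<ge>1. svgd_solution \<Theta> K (p l) (\<mu> l)) \<and>
     \<mu> 1 0 = \<mu>0 \<and>
     (\<forall>l\<ge>2. \<mu> l 0 = ml_density p tol \<mu> (l - 1))"

definition high_fidelity_level ::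
  "(nat \<Rightarrow> 'a::euclidean_space \<Rightarrow> real) \<Rightarrow> ('a \<Rightarrow> real) \<Rightarrow> (nat \<Rightarrow> real) \<Rightarrow> real \<Rightarrow> nat" where
  "high_fidelity_level p q tol \<epsilon> =
     (LEAST L. 1 \<le> L \<and> hellinger (p L) q \<le> \<epsilon> / 2 \<and> tol L \<le> \<epsilon>)"

definition ml_cost ::
  "(nat \<Rightarrow> real) \<Rightarrow> (nat \<Rightarrow> 'a::euclidean_space \<Rightarrow> real) \<Rightarrow> (nat \<Rightarrow> real) \<Rightarrow>
   (nat \<Rightarrow> real \<Rightarrow> 'a \<Rightarrow> real) \<Rightarrow> nat \<Rightarrow> real" where
  "ml_cost c p tol \<mu> L = (\<Sum>l=1..L. c l * ml_stop_time p tol \<mu> l)"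

definition level_integrand ::
  "(nat \<Rightarrow> 'a::euclidean_space \<Rightarrow> real) \<Rightarrow> (nat \<Rightarrow> real) \<Rightarrow> (nat \<Rightarrow> real \<Rightarrow> 'a \<Rightarrow> real) \<Rightarrow> nat \<Rightarrow> 'a \<Rightarrow> real" where
  "level_integrand p tol \<mu> l \<theta> =
     (ml_density p tol \<mu> (l - 1) \<theta> - p (l - 1) \<theta>) * ln (p (l - 1) \<theta> / p l \<theta>)"

definition level_remainder ::
  "(nat \<Rightarrow> 'a::euclidean_space \<Rightarrow> real) \<Rightarrow> (nat \<Rightarrow> real) \<Rightarrow> (nat \<Rightarrow> real \<Rightarrow> 'a \<Rightarrow> real) \<Rightarrow> nat \<Rightarrow> real" where
  "level_remainder p tol \<mu> l = (\<integral>\<theta>. level_integrand p tol \<mu> l \<theta> \<partial>lborel)"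

text \<open>The infimum equals the minimum whenever that is attained, and hence the ordinary inverse of
  \<open>r\<close> on its range when \<open>r\<close> is injective. It is not attained where \<open>r\<close> fails to be
  right-continuous, and there a minimum would be undefined.\<close>

definition rate_inverse :: "(real \<Rightarrow> real) \<Rightarrow> real \<Rightarrow> real" where
  "rate_inverse r x = Inf {t. 0 \<le> t \<and> r t \<le> x}"

end

theory Submission
  imports Defs "HOL-Real_Asymp.Real_Asymp"
begin

text \<open>At each level the previous output serves as the initial density. The logarithm of the density
  ratio splits as \<open>ln (m / p\<^sub>l) = ln (m / p\<^sub>l\<^sub>-\<^sub>1) + ln (p\<^sub>l\<^sub>-\<^sub>1 / p\<^sub>l)\<close>, so the
  initial divergence is at most \<open>1 / x\<close> times the prescribed tolerance \<open>k1 s\<^sup>-\<^sup>\<alpha>\<^sup>l\<close>, with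
  \<open>x = 1 / (s\<^sup>\<alpha> + (k2 + k3) / k1)\<close>. The decay rate then bounds every stopping time by
  \<open>r\<^sup>-\<^sup>1(x)\<close>, and the cost is dominated by a geometric sum.

  Stopping times and \<open>r\<^sup>-\<^sup>1(x)\<close> are infima of sublevel sets; they can be used as minima because
  \<open>t \<mapsto> KL (\<nu> t) p\<close> is lower semicontinuous: this is Fatou's lemma for the nonnegative integrand
  \<open>f ln (f / g) - f + g\<close>, which is continuous in \<open>f\<close> even at \<open>f = 0\<close>.\<close>

subsection \<open>Relative entropy of densities\<close>

lemma prob_density_onD:
  assumes "prob_density_on \<Theta> f"
  shows "f \<in> borel_measurable borel" "0 \<le> f x" "x \<notin> \<Theta> \<Longrightarrow> f x = 0"
    "integrable lborel f" "integral\<^sup>L lborel f = 1"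
proof -
  show nonneg: "0 \<le> f x" for x using assms by (simp add: prob_density_on_def)
  show "x \<notin> \<Theta> \<Longrightarrow> f x = 0" and [measurable]: "f \<in> borel_measurable borel"
    using assms by (auto simp: prob_density_on_def)
  have "prob_space (density lborel f)"
    using assms by (simp add: prob_density_on_def)
  from prob_space.emeasure_space_1[OF this] have "emeasure (density lborel f) UNIV = 1"
    by simp
  then have "(\<integral>\<^sup>+x. ennreal (f x) \<partial>lborel) = ennreal 1"
    by (simp add: emeasure_density)
  then have "has_bochner_integral lborel f 1"
    using nonneg by (intro has_bochner_integral_nn_integral) auto
  then show "integrable lborel f" "integral\<^sup>L lborel f = 1"
    by (auto simp: has_bochner_integral_iff)
qed

text \<open>A set is null for a density exactly when the density vanishes almost everywhere on it.
  Testing absolute continuity on the zero set of \<open>g\<close> gives one direction, and the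
  pointwise implication transfers null sets for the other.\<close>

lemma absolutely_continuous_density_iff:
  fixes f g :: "'a \<Rightarrow> real"
  assumes [measurable]: "f \<in> borel_measurable M" "g \<in> borel_measurable M"
    and "\<And>x. 0 \<le> f x" "\<And>x. 0 \<le> g x"
  shows "absolutely_continuous (density M g) (density M f) \<longleftrightarrow> (AE x in M. g x = 0 \<longrightarrow> f x = 0)"
proof
  assume ac: "absolutely_continuous (density M g) (density M f)"
  have "{x \<in> space M. g x = 0} \<in> null_sets (density M g)"
    by (subst null_sets_density_iff) auto
  with ac have "{x \<in> space M. g x = 0} \<in> null_sets (density M f)"
    by (auto simp: absolutely_continuous_def)
  then have "AE x in M. x \<in> {x \<in> space M. g x = 0} \<longrightarrow> ennreal (f x) = 0"
    by (subst (asm) null_sets_density_iff) auto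
  then show "AE x in M. g x = 0 \<longrightarrow> f x = 0"
    using AE_space by eventually_elim (use assms(3) in \<open>auto simp: ennreal_eq_0_iff intro: antisym\<close>)
next
  assume 0: "AE x in M. g x = 0 \<longrightarrow> f x = 0"
  show "absolutely_continuous (density M g) (density M f)"
    unfolding absolutely_continuous_def
  proof
    fix A assume "A \<in> null_sets (density M g)"
    then have A: "A \<in> sets M" "AE x in M. x \<in> A \<longrightarrow> ennreal (g x) = 0"
      by (auto simp: null_sets_density_iff)
    have "AE x in M. x \<in> A \<longrightarrow> ennreal (f x) = 0"
      using A(2) 0 by eventually_elim (use assms(4) in \<open>auto simp: ennreal_eq_0_iff intro: antisym\<close>)
    with A(1) show "A \<in> null_sets (density M f)"
      by (auto simp: null_sets_density_iff)
  qed
qed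

text \<open>By uniqueness, \<open>f / g\<close> is a version of the Radon-Nikodym derivative.
  Uniqueness holds only almost everywhere for \<open>density lborel g\<close>, that is, where
  \<open>g\<close> is positive; elsewhere \<open>f\<close> vanishes almost everywhere by
  \<open>ac\<close>, so the integrands still agree.\<close>

lemma integrable_entropy_density_iff:
  fixes f g :: "'a::euclidean_space \<Rightarrow> real"
  assumes "prob_density_on \<Theta> f" "prob_density_on \<Theta> g"
    and ac: "AE x in lborel. g x = 0 \<longrightarrow> f x = 0"
  shows "integrable (density lborel f)
      (entropy_density (exp 1) (density lborel g) (density lborel f)) \<longleftrightarrow>
    integrable lborel (\<lambda>x. f x * ln (f x / g x))"
proof -
  note f = prob_density_onD[OF assms(1)] and g = prob_density_onD[OF assms(2)]
  note [measurable] = f(1) g(1)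
  let ?N = "density lborel g"
  interpret N: sigma_finite_measure ?N
    using assms(2) by (auto simp: prob_density_on_def intro: prob_space_imp_sigma_finite)
  have d: "density ?N (\<lambda>x. ennreal (f x / g x)) = density lborel f"
    using f g ac by (subst density_density_divide) auto
  have "AE x in ?N. ennreal (f x / g x) = RN_deriv ?N (density lborel f) x"
    by (rule N.RN_deriv_unique[OF _ d]) measurable
  then have "AE x in lborel. 0 < g x \<longrightarrow> ennreal (f x / g x) = RN_deriv ?N (density lborel f) x"
    by (subst (asm) AE_density) auto
  then have eq: "AE x in lborel. f x *\<^sub>R entropy_density (exp 1) ?N (density lborel f) x = f x * ln (f x / g x)"
    using ac
  proof eventually_elim
    case (elim x)
    show ?case
    proof (cases "g x = 0")
      case False
      then have "0 < g x" using g(2)[of x] by simp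
      with elim(1) have "enn2real (RN_deriv ?N (density lborel f) x) = f x / g x"
        using f(2)[of x] by (metis divide_nonneg_pos enn2real_ennreal)
      then show ?thesis by (simp add: entropy_density_def log_def)
    qed (use elim in auto)
  qed
  have [measurable]: "entropy_density (exp 1) ?N (density lborel f) \<in> borel_measurable lborel"
    using measurable_entropy_density[of "exp 1" ?N "density lborel f"] by simp
  have "integrable (density lborel f) (entropy_density (exp 1) ?N (density lborel f)) \<longleftrightarrow>
      integrable lborel (\<lambda>x. f x *\<^sub>R entropy_density (exp 1) ?N (density lborel f) x)"
    using f(2) by (intro integrable_density) auto
  also have "\<dots> \<longleftrightarrow> integrable lborel (\<lambda>x. f x * ln (f x / g x))"
    by (rule integrable_cong_AE[OF _ _ eq]) measurable
  finally show ?thesis .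
qed

text \<open>Replaces Radon-Nikodym derivatives by an explicit Lebesgue integral, the form in which
  all later estimates are made.\<close>

lemma KL_eq:
  fixes f g :: "'a::euclidean_space \<Rightarrow> real"
  assumes "prob_density_on \<Theta> f" "prob_density_on \<Theta> g"
  shows "KL f g =
    (if (AE x in lborel. g x = 0 \<longrightarrow> f x = 0) \<and> integrable lborel (\<lambda>x. f x * ln (f x / g x))
     then ereal (\<integral>x. f x * ln (f x / g x) \<partial>lborel) else \<infinity>)"
proof -
  note f = prob_density_onD[OF assms(1)] and g = prob_density_onD[OF assms(2)]
  have "absolutely_continuous (density lborel g) (density lborel f) \<longleftrightarrow>
      (AE x in lborel. g x = 0 \<longrightarrow> f x = 0)"
    using f g by (intro absolutely_continuous_density_iff) auto
  moreover have "KL_divergence (exp 1) (density lborel g) (density lborel f) =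
      (\<integral>x. f x * ln (f x / g x) \<partial>lborel)" if "AE x in lborel. g x = 0 \<longrightarrow> f x = 0"
    using lborel.KL_density_density[of "exp 1" g f] f g that by (simp add: log_def)
  ultimately show ?thesis
    using integrable_entropy_density_iff[OF assms] by (auto simp: KL_def)
qed

lemma KL_le_ereal_iff:
  fixes f g :: "'a::euclidean_space \<Rightarrow> real"
  assumes "prob_density_on \<Theta> f" "prob_density_on \<Theta> g"
  shows "KL f g \<le> ereal a \<longleftrightarrow>
    (AE x in lborel. g x = 0 \<longrightarrow> f x = 0) \<and> integrable lborel (\<lambda>x. f x * ln (f x / g x)) \<and>
    (\<integral>x. f x * ln (f x / g x) \<partial>lborel) \<le> a"
  by (auto simp: KL_eq[OF assms])

text \<open>Integrate the splitting of the logarithm, with the weight of \<open>ln (p / q)\<close>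
  written as \<open>m = p + (m - p)\<close>: the three terms are bounded by \<open>a\<close>,
  \<open>b\<close> and \<open>d\<close>. The hypothesis \<open>int\<close> gives the bound
  \<open>le\<close> its force, since the Bochner integral of a non-integrable function is 0.\<close>

lemma KL_le_add:
  fixes m p q :: "'a::euclidean_space \<Rightarrow> real"
  assumes dens: "prob_density_on \<Theta> m" "prob_density_on \<Theta> p" "prob_density_on \<Theta> q"
    and pos: "\<And>x. x \<in> \<Theta> \<Longrightarrow> 0 < p x" "\<And>x. x \<in> \<Theta> \<Longrightarrow> 0 < q x"
    and mp: "KL m p \<le> ereal a" and pq: "KL p q \<le> ereal b"
    and int: "integrable lborel (\<lambda>x. (m x - p x) * ln (p x / q x))"
    and le: "(\<integral>x. (m x - p x) * ln (p x / q x) \<partial>lborel) \<le> d"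
  shows "KL m q \<le> ereal (a + b + d)"
proof -
  note m = prob_density_onD[OF dens(1)] and p = prob_density_onD[OF dens(2)]
  note mp = mp[unfolded KL_le_ereal_iff[OF dens(1,2)]] and pq = pq[unfolded KL_le_ereal_iff[OF dens(2,3)]]
  let ?h = "\<lambda>x. m x * ln (m x / p x) + p x * ln (p x / q x) + (m x - p x) * ln (p x / q x)"
  \<comment> \<open>Where \<open>m x = 0\<close>, in particular outside \<Theta>, the last two terms
    of \<open>?h\<close> cancel. Elsewhere all three densities are positive and the logarithms
    split.\<close>
  have split: "m x * ln (m x / q x) = ?h x" for x
  proof (cases "m x = 0")
    case False
    then have "x \<in> \<Theta>" using m(3) by blast
    with False m(2)[of x] pos[of x] show ?thesis
      by (simp add: ln_div algebra_simps)
  qed (simp add: algebra_simps)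
  have "AE x in lborel. q x = 0 \<longrightarrow> m x = 0"
    using m(3) pos(2) by (intro AE_I2) force
  moreover have "integrable lborel ?h" "integral\<^sup>L lborel ?h \<le> a + b + d"
    using mp pq int le by auto
  ultimately show ?thesis
    by (simp add: KL_le_ereal_iff[OF dens(1,3)] split)
qed

subsection \<open>Lower semicontinuity\<close>

text \<open>The only delicate point is 0, where the function takes the value 0, which is also its
  limit from the right.\<close>

lemma continuous_on_mult_ln_div:
  fixes c :: real
  assumes "0 < c"
  shows "continuous_on {0..} (\<lambda>y. y * ln (y / c))"
  unfolding continuous_on_eq_continuous_within
proof
  fix y :: real assume "y \<in> {0..}"
  then consider "y = 0" | "0 < y" by fastforce
  then show "continuous (at y within {0..}) (\<lambda>y. y * ln (y / c))"
  proof cases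
    case 1
    have "((\<lambda>y. y * ln (y / c)) \<longlongrightarrow> 0) (at_right 0)"
      using assms by real_asymp
    then show ?thesis
      using 1 by (simp add: continuous_within at_within_Ici_at_right)
  next
    case 2
    then have "isCont (\<lambda>y. y * ln (y / c)) y"
      using assms by (intro continuous_intros) auto
    then show ?thesis by (rule continuous_within_subset) simp
  qed
qed

text \<open>This is \<open>ln u \<le> u - 1\<close> at \<open>u = g / f\<close>, multiplied by
  \<open>f\<close>.\<close>

lemma entropy_integrand_nonneg:
  fixes f g :: real
  assumes "0 \<le> f" "0 < g"
  shows "0 \<le> f * ln (f / g) - f + g"
proof (cases "f = 0")
  case False
  then have "0 < f" using assms by simp
  have "ln (g / f) \<le> g / f - 1"
    using \<open>0 < f\<close> assms by (intro ln_le_minus_one) simp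
  then have "f * ln (g / f) \<le> f * (g / f - 1)"
    using \<open>0 < f\<close> by (intro mult_left_mono) auto
  then show ?thesis
    using \<open>0 < f\<close> assms by (simp add: ln_div algebra_simps)
qed (use assms in simp)

text \<open>Sequential lower semicontinuity. The terms \<open>- f + g\<close> integrate to 0 because
  both densities have mass 1, so they make the integrand nonnegative without changing its integral.
  Convergence is required only on \<Theta>, since all the densities vanish outside it.\<close>

lemma KL_le_ereal_sequentially:
  fixes g :: "'a::euclidean_space \<Rightarrow> real"
  assumes F: "\<And>n. prob_density_on \<Theta> (F n)" and f: "prob_density_on \<Theta> f"
    and g: "prob_density_on \<Theta> g" and pos: "\<And>x. x \<in> \<Theta> \<Longrightarrow> 0 < g x"
    and lim: "\<And>x. x \<in> \<Theta> \<Longrightarrow> (\<lambda>n. F n x) \<longlonglongrightarrow> f x"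
    and le: "\<And>n. KL (F n) g \<le> ereal a"
  shows "KL f g \<le> ereal a"
proof -
  note fD = prob_density_onD[OF f] and gD = prob_density_onD[OF g] and FD = prob_density_onD[OF F]
  note [measurable] = fD(1) gD(1) FD(1)
  define \<phi> where "\<phi> h x = h x * ln (h x / g x) - h x + g x" for h x
  have nonneg: "0 \<le> \<phi> h x" if "prob_density_on \<Theta> h" for h x
    using prob_density_onD(2,3)[OF that, of x] gD(2,3)[of x] pos[of x]
    by (cases "x \<in> \<Theta>") (auto simp: \<phi>_def intro: entropy_integrand_nonneg)
  have [measurable]: "\<phi> f \<in> borel_measurable borel" "\<And>n. \<phi> (F n) \<in> borel_measurable borel"
    unfolding \<phi>_def by measurable
  have conv: "(\<lambda>n. \<phi> (F n) x) \<longlonglongrightarrow> \<phi> f x" for x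
  proof (cases "x \<in> \<Theta>")
    case True
    have "(\<lambda>n. F n x * ln (F n x / g x)) \<longlonglongrightarrow> f x * ln (f x / g x)"
      using continuous_on_tendsto_compose[OF continuous_on_mult_ln_div[OF pos[OF True]] lim[OF True]]
        fD(2) FD(2) by simp
    then show ?thesis
      unfolding \<phi>_def by (intro tendsto_add tendsto_diff tendsto_const lim[OF True])
  qed (simp add: \<phi>_def fD(3) FD(3))
  have int: "(\<integral>\<^sup>+x. ennreal (\<phi> (F n) x) \<partial>lborel) \<le> ennreal a" for n
  proof -
    have le': "integrable lborel (\<lambda>x. F n x * ln (F n x / g x))"
      "(\<integral>x. F n x * ln (F n x / g x) \<partial>lborel) \<le> a"
      using le[of n] by (auto simp: KL_le_ereal_iff[OF F g])
    then have "integrable lborel (\<phi> (F n))" "integral\<^sup>L lborel (\<phi> (F n)) \<le> a"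
      using FD(4,5) gD(4,5) by (auto simp: \<phi>_def[abs_def])
    then show ?thesis
      using nonneg[OF F] by (subst nn_integral_eq_integral) (auto intro: ennreal_leI)
  qed
  \<comment> \<open>\<open>ennreal\<close> sends negative numbers to 0, so the Fatou bound by
    \<open>ennreal a\<close> yields a real bound by \<open>a\<close> only once \<open>a\<close> is
    known to be nonnegative.\<close>
  have "0 \<le> integral\<^sup>L lborel (\<phi> (F 0))"
    using nonneg[OF F] by simp
  also have "\<dots> \<le> a"
    using le[of 0] FD(4,5) gD(4,5) by (auto simp: \<phi>_def[abs_def] KL_le_ereal_iff[OF F g])
  finally have "0 \<le> a" .
  have "(\<integral>\<^sup>+x. ennreal (\<phi> f x) \<partial>lborel) = (\<integral>\<^sup>+x. liminf (\<lambda>n. ennreal (\<phi> (F n) x)) \<partial>lborel)"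
    by (intro nn_integral_cong lim_imp_Liminf[symmetric]) (auto intro: conv)
  also have "\<dots> \<le> liminf (\<lambda>n. \<integral>\<^sup>+x. ennreal (\<phi> (F n) x) \<partial>lborel)"
    by (intro nn_integral_liminf) measurable
  also have "\<dots> \<le> liminf (\<lambda>n. ennreal a)"
    by (intro Liminf_mono always_eventually allI int)
  also have "\<dots> = ennreal a"
    by (simp add: Liminf_const)
  finally have bound: "(\<integral>\<^sup>+x. ennreal (\<phi> f x) \<partial>lborel) \<le> ennreal a" .
  then have int_\<phi>: "integrable lborel (\<phi> f)"
    using nonneg[OF f] by (intro integrableI_nonneg) (auto simp: top_unique intro: le_less_trans)
  then have le_\<phi>: "integral\<^sup>L lborel (\<phi> f) \<le> a"
    using bound nonneg[OF f] \<open>0 \<le> a\<close> by (simp add: nn_integral_eq_integral)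
  have eq: "f x * ln (f x / g x) = \<phi> f x + f x - g x" for x
    by (simp add: \<phi>_def)
  have "AE x in lborel. g x = 0 \<longrightarrow> f x = 0"
    using fD(3) pos by (intro AE_I2) force
  moreover have "integrable lborel (\<lambda>x. \<phi> f x + f x - g x)"
    "(\<integral>x. \<phi> f x + f x - g x \<partial>lborel) \<le> a"
    using int_\<phi> le_\<phi> fD(4,5) gD(4,5) by auto
  ultimately show ?thesis
    by (simp add: KL_le_ereal_iff[OF f g] eq)
qed

section \<open>Stopping times and the inverse of the decay rate\<close>

lemma svgd_solutionD:
  assumes "svgd_solution \<Theta> K p \<nu>"
  shows "\<theta> \<in> \<Theta> \<Longrightarrow> 0 < p \<theta>" "0 \<le> t \<Longrightarrow> prob_density_on \<Theta> (\<nu> t)"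
    "\<theta> \<in> \<Theta> \<Longrightarrow> continuous_on {0..} (\<lambda>t. \<nu> t \<theta>)"
  using assms by (auto simp: svgd_solution_def)

text \<open>Continuity in time at each point of \<Theta> turns \<open>\<tau> n\<close> tending to
  \<open>t\<close> into pointwise convergence of densities, to which lower semicontinuity
  applies.\<close>

lemma closed_KL_sublevel:
  assumes sol: "svgd_solution \<Theta> K p \<nu>" and p: "prob_density_on \<Theta> p"
  shows "closed {t. 0 \<le> t \<and> KL (\<nu> t) p \<le> ereal a}"
  unfolding closed_sequential_limits
proof (intro allI impI, elim conjE)
  fix \<tau> t assume \<tau>: "\<forall>n. \<tau> n \<in> {t. 0 \<le> t \<and> KL (\<nu> t) p \<le> ereal a}" and lim: "\<tau> \<longlonglongrightarrow> t"
  have "0 \<le> t"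
    using \<tau> by (intro LIMSEQ_le_const[OF lim]) auto
  moreover have "KL (\<nu> t) p \<le> ereal a"
  proof (rule KL_le_ereal_sequentially[where F = "\<lambda>n. \<nu> (\<tau> n)", OF _ _ p])
    show "prob_density_on \<Theta> (\<nu> (\<tau> n))" "KL (\<nu> (\<tau> n)) p \<le> ereal a" for n
      using svgd_solutionD(2)[OF sol] \<tau> by auto
    show "(\<lambda>n. \<nu> (\<tau> n) x) \<longlonglongrightarrow> \<nu> t x" if "x \<in> \<Theta>" for x
      using continuous_on_tendsto_compose[OF svgd_solutionD(3)[OF sol that] lim] \<tau> \<open>0 \<le> t\<close> by simp
  qed (fact svgd_solutionD(1,2)[OF sol] svgd_solutionD(2)[OF sol \<open>0 \<le> t\<close>])+
  ultimately show "t \<in> {t. 0 \<le> t \<and> KL (\<nu> t) p \<le> ereal a}" by simp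
qed

text \<open>The time \<open>T\<close> witnesses that the sublevel set is nonempty. Being also closed
  and bounded below, the set contains its infimum, which is therefore the value of
  \<open>LEAST\<close>.\<close>

lemma svgd_stop_time:
  assumes "svgd_solution \<Theta> K p \<nu>" "prob_density_on \<Theta> p"
    and T: "0 \<le> T" "KL (\<nu> T) p \<le> ereal (e\<^sup>2 / 2)"
  shows "0 \<le> svgd_stop_time p \<nu> e" "svgd_stop_time p \<nu> e \<le> T"
    "KL (\<nu> (svgd_stop_time p \<nu> e)) p \<le> ereal (e\<^sup>2 / 2)"
proof -
  define S where "S = {t. 0 \<le> t \<and> KL (\<nu> t) p \<le> ereal (e\<^sup>2 / 2)}"
  have bdd: "bdd_below S"
    unfolding S_def by (rule bdd_belowI[of _ 0]) simp
  have "closed S"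
    unfolding S_def by (rule closed_KL_sublevel[OF assms(1,2)])
  then have "Inf S \<in> S"
    using T bdd by (intro closed_contains_Inf) (auto simp: S_def)
  moreover have Inf_le: "Inf S \<le> t" if "t \<in> S" for t
    using that bdd by (rule cInf_lower)
  ultimately have "svgd_stop_time p \<nu> e = Inf S"
    unfolding svgd_stop_time_def by (intro Least_equality) (auto simp: S_def)
  moreover have "T \<in> S"
    using T by (simp add: S_def)
  ultimately have "svgd_stop_time p \<nu> e \<in> S" "svgd_stop_time p \<nu> e \<le> T"
    using \<open>Inf S \<in> S\<close> Inf_le by simp_all
  then show "0 \<le> svgd_stop_time p \<nu> e" "svgd_stop_time p \<nu> e \<le> T"
    "KL (\<nu> (svgd_stop_time p \<nu> e)) p \<le> ereal (e\<^sup>2 / 2)"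
    unfolding S_def by simp_all
qed

text \<open>As \<open>r\<close> tends to 0, it falls below the positive \<open>x\<close> at some
  nonnegative time. The infimum is thus over a nonempty set of nonnegative numbers.\<close>

lemma rate_inverse_nonneg:
  assumes "(r \<longlongrightarrow> 0) at_top" "0 < x"
  shows "{t. 0 \<le> t \<and> r t \<le> x} \<noteq> {}" "0 \<le> rate_inverse r x"
proof -
  have "eventually (\<lambda>t. r t < x \<and> 0 \<le> t) at_top"
    using order_tendstoD(2)[OF assms] eventually_ge_at_top[of 0] by eventually_elim simp
  then obtain t where "r t < x" "0 \<le> t"
    using eventually_happens'[OF trivial_limit_at_top_linorder] by blast
  then have "t \<in> {t. 0 \<le> t \<and> r t \<le> x}"
    by simp
  then show "{t. 0 \<le> t \<and> r t \<le> x} \<noteq> {}"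
    by blast
  then show "0 \<le> rate_inverse r x"
    unfolding rate_inverse_def by (rule cInf_greatest) simp
qed

text \<open>\<^term>\<open>r (rate_inverse r x) \<le> x\<close> may fail, but it holds at every later time, and the divergence
  bound passes to the limit.\<close>

lemma KL_at_rate_inverse:
  assumes sol: "svgd_solution \<Theta> K p \<nu>" "prob_density_on \<Theta> p"
    and r: "antimono_on {0..} r" "(r \<longlongrightarrow> 0) at_top" and x: "0 < x"
    and decay: "\<And>t. 0 \<le> t \<Longrightarrow> KL (\<nu> t) p \<le> ereal (r t) * KL (\<nu> 0) p"
    and init: "KL (\<nu> 0) p \<le> ereal a" "x * a \<le> b"
    and r_nonneg: "\<And>t. 0 \<le> t \<Longrightarrow> 0 \<le> r t"
    and a: "0 \<le> a"
  shows "KL (\<nu> (rate_inverse r x)) p \<le> ereal b"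
proof -
  define T where "T = rate_inverse r x"
  note T0 = rate_inverse_nonneg[OF r(2) x, folded T_def]
  have le: "KL (\<nu> t) p \<le> ereal b" if t: "T < t" for t
  proof -
    obtain u where u: "0 \<le> u" "r u \<le> x" "u < t"
      using cInf_lessD[OF T0(1) t[unfolded T_def rate_inverse_def]] by blast
    then have "r t \<le> r u"
      by (intro monotone_onD[OF r(1)]) auto
    with u(2) have "r t \<le> x" by simp
    have "KL (\<nu> t) p \<le> ereal (r t) * KL (\<nu> 0) p"
      using u by (intro decay) simp
    also have "\<dots> \<le> ereal (r t) * ereal a"
      using r_nonneg[of t] u init(1) by (intro ereal_mult_left_mono) auto
    also have "\<dots> \<le> ereal b"
      using mult_right_mono[OF \<open>r t \<le> x\<close> a] init(2) by simp
    finally show ?thesis .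
  qed
  \<comment> \<open>These times approach \<open>T\<close> strictly from the right, where
    \<open>le\<close> applies.\<close>
  have "(\<lambda>n. T + 1 / real (Suc n)) \<longlonglongrightarrow> T + 0"
    using LIMSEQ_inverse_real_of_nat by (intro tendsto_intros) (simp add: inverse_eq_divide)
  moreover have "T + 1 / real (Suc n) \<in> {t. 0 \<le> t \<and> KL (\<nu> t) p \<le> ereal b}" for n
    using T0 le by simp
  ultimately have "T \<in> {t. 0 \<le> t \<and> KL (\<nu> t) p \<le> ereal b}"
    using closed_KL_sublevel[OF sol] by (metis (lifting) add.right_neutral closed_sequentially)
  then show ?thesis by (simp add: T_def)
qed

subsection \<open>Hellinger distance\<close>

text \<open>The product of the roots is dominated by \<open>f + g\<close>, by the
  arithmetic-geometric mean inequality; expanding the square reduces the first claim to the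
  second.\<close>

lemma integrable_hellinger:
  fixes f g :: "'a::euclidean_space \<Rightarrow> real"
  assumes "prob_density_on \<Theta> f" "prob_density_on \<Theta> g"
  shows "integrable lborel (\<lambda>x. (sqrt (f x) - sqrt (g x))\<^sup>2)"
    "integrable lborel (\<lambda>x. sqrt (f x) * sqrt (g x))"
proof -
  note f = prob_density_onD[OF assms(1)] and g = prob_density_onD[OF assms(2)]
  note [measurable] = f(1) g(1)
  have "norm (sqrt (f x) * sqrt (g x)) \<le> norm (f x + g x)" for x
    using sum_squares_bound[of "sqrt (f x)" "sqrt (g x)"] f(2)[of x] g(2)[of x] by (simp add: abs_mult)
  then show *: "integrable lborel (\<lambda>x. sqrt (f x) * sqrt (g x))"
    by (intro Bochner_Integration.integrable_bound[OF Bochner_Integration.integrable_add[OF f(4) g(4)]]) auto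
  have "(sqrt (f x) - sqrt (g x))\<^sup>2 = f x + g x - 2 * (sqrt (f x) * sqrt (g x))" for x
    using f(2)[of x] g(2)[of x] by (simp add: power2_diff)
  then show "integrable lborel (\<lambda>x. (sqrt (f x) - sqrt (g x))\<^sup>2)"
    using * f(4) g(4) by simp
qed

lemma hellinger_power2:
  "(hellinger f g)\<^sup>2 = (\<integral>x. (sqrt (f x) - sqrt (g x))\<^sup>2 \<partial>lborel) / 2" "0 \<le> hellinger f g"
  by (simp_all add: hellinger_def)

text \<open>Applying \<open>ln u \<le> u - 1\<close> to \<open>u = sqrt (g / f)\<close> gives
  \<open>f * ln (f / g) \<ge> 2 * f - 2 * sqrt f * sqrt g\<close> pointwise, and the right-hand side
  integrates to twice the squared distance.\<close>

lemma hellinger_power2_le_KL: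
  fixes f g :: "'a::euclidean_space \<Rightarrow> real"
  assumes "prob_density_on \<Theta> f" "prob_density_on \<Theta> g"
  shows "ereal (2 * (hellinger f g)\<^sup>2) \<le> KL f g"
proof -
  note f = prob_density_onD[OF assms(1)] and g = prob_density_onD[OF assms(2)]
  have "2 * (hellinger f g)\<^sup>2 \<le> (\<integral>x. f x * ln (f x / g x) \<partial>lborel)"
    if ac: "AE x in lborel. g x = 0 \<longrightarrow> f x = 0" and int: "integrable lborel (\<lambda>x. f x * ln (f x / g x))"
  proof -
    have sq: "(sqrt (f x) - sqrt (g x))\<^sup>2 = f x + g x - 2 * (sqrt (f x) * sqrt (g x))" for x
      using f(2)[of x] g(2)[of x] by (simp add: power2_diff)
    have "2 * (hellinger f g)\<^sup>2 = (\<integral>x. f x + g x - 2 * (sqrt (f x) * sqrt (g x)) \<partial>lborel)"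
      by (simp add: hellinger_power2 sq)
    \<comment> \<open>Both densities have integral 1, so \<open>g\<close> may be exchanged for
      \<open>f\<close>; only then does the comparison hold pointwise.\<close>
    also have "\<dots> = (\<integral>x. 2 * f x - 2 * (sqrt (f x) * sqrt (g x)) \<partial>lborel)"
      using f(4,5) g(4,5) integrable_hellinger(2)[OF assms] by simp
    also have "\<dots> \<le> (\<integral>x. f x * ln (f x / g x) \<partial>lborel)"
    proof (rule integral_mono_AE[OF _ int])
      show "AE x in lborel. 2 * f x - 2 * (sqrt (f x) * sqrt (g x)) \<le> f x * ln (f x / g x)"
        using ac
      proof eventually_elim
        case (elim x)
        show ?case
        proof (cases "f x = 0")
          case False
          with elim f(2)[of x] g(2)[of x] have pos: "0 < f x" "0 < g x" by (auto simp: order_less_le)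
          have "f x * (sqrt (g x) / sqrt (f x)) = sqrt (f x) * sqrt (g x)"
            using pos by (metis less_imp_le real_div_sqrt times_divide_eq_left times_divide_eq_right)
          then have "2 * f x - 2 * (sqrt (f x) * sqrt (g x)) = f x * (2 - 2 * (sqrt (g x) / sqrt (f x)))"
            by (simp only: right_diff_distrib mult.left_commute[of "f x" 2] mult.commute[of "f x" 2])
          moreover have "ln (sqrt (g x / f x)) \<le> sqrt (g x / f x) - 1"
            using pos by (intro ln_le_minus_one) simp
          then have "f x * (2 - 2 * (sqrt (g x) / sqrt (f x))) \<le> f x * ln (f x / g x)"
            using pos by (intro mult_left_mono) (auto simp: ln_sqrt ln_div real_sqrt_divide)
          ultimately show ?thesis by (simp only:)
        qed simp
      qed
    qed (use f(4) integrable_hellinger(2)[OF assms] in auto)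
    finally show ?thesis .
  qed
  then show ?thesis by (simp add: KL_eq[OF assms])
qed

text \<open>The threshold has the form of the stopping criterion, so a run stopped at tolerance
  \<open>e\<close> is within \<open>e / 2\<close> of its target.\<close>

lemma hellinger_le_of_KL:
  assumes "prob_density_on \<Theta> f" "prob_density_on \<Theta> g" "KL f g \<le> ereal (e\<^sup>2 / 2)" "0 \<le> e"
  shows "hellinger f g \<le> e / 2"
proof (rule power2_le_imp_le)
  have "ereal (2 * (hellinger f g)\<^sup>2) \<le> ereal (e\<^sup>2 / 2)"
    using hellinger_power2_le_KL[OF assms(1,2)] assms(3) by (rule order_trans)
  then show "(hellinger f g)\<^sup>2 \<le> (e / 2)\<^sup>2"
    by (simp add: power_divide)
qed (use assms in simp)

text \<open>The triangle inequality for two distances with a common bound. In this case the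
  pointwise estimate of \<open>(a - c)\<^sup>2\<close> by
  \<open>2 * (a - b)\<^sup>2 + 2 * (b - c)\<^sup>2\<close> loses nothing.\<close>

lemma hellinger_le_twice:
  assumes "prob_density_on \<Theta> f" "prob_density_on \<Theta> g" "prob_density_on \<Theta> h"
    and fg: "hellinger f g \<le> e" and gh: "hellinger g h \<le> e"
  shows "hellinger f h \<le> 2 * e"
proof (rule power2_le_imp_le)
  let ?d = "\<lambda>u v x. (sqrt (u x) - sqrt (v x))\<^sup>2 :: real"
  note int = integrable_hellinger(1)[OF assms(1,2)] integrable_hellinger(1)[OF assms(2,3)]
    integrable_hellinger(1)[OF assms(1,3)]
  have "(a - c)\<^sup>2 \<le> 2 * (a - b)\<^sup>2 + 2 * (b - c)\<^sup>2" for a b c :: real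
    using sum_squares_bound[of "a - b" "b - c"] by (simp add: power2_eq_square algebra_simps)
  then have "(\<integral>x. ?d f h x \<partial>lborel) \<le> (\<integral>x. 2 * ?d f g x + 2 * ?d g h x \<partial>lborel)"
    using int by (intro integral_mono) auto
  also have "\<dots> = 2 * (\<integral>x. ?d f g x \<partial>lborel) + 2 * (\<integral>x. ?d g h x \<partial>lborel)"
    using int by simp
  finally have "(hellinger f h)\<^sup>2 \<le> 2 * (hellinger f g)\<^sup>2 + 2 * (hellinger g h)\<^sup>2"
    by (simp add: hellinger_power2)
  also have "\<dots> \<le> 2 * e\<^sup>2 + 2 * e\<^sup>2"
    using fg gh hellinger_power2(2) by (intro add_mono mult_left_mono power_mono) auto
  finally show "(hellinger f h)\<^sup>2 \<le> (2 * e)\<^sup>2"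
    by (simp add: power2_eq_square)
  show "0 \<le> 2 * e" using fg hellinger_power2(2)[of f g] by simp
qed

subsection \<open>Cost of the multilevel hierarchy\<close>

text \<open>Multiplication by \<open>s powr \<gamma> - 1\<close> telescopes the sum; the negative
  end term is dropped.\<close>

lemma sum_powr_geometric_le:
  fixes s \<gamma> :: real
  assumes "1 < s" "0 < \<gamma>"
  shows "(\<Sum>l=1..L. s powr (\<gamma> * real l)) \<le> s powr \<gamma> * s powr (\<gamma> * real L) / (s powr \<gamma> - 1)"
proof -
  have q: "1 < s powr \<gamma>" using assms by simp
  have "(s powr \<gamma> - 1) * (\<Sum>l=1..L. s powr (\<gamma> * real l)) = s powr \<gamma> * s powr (\<gamma> * real L) - s powr \<gamma>"
  proof (induction L)
    case (Suc L)
    have "s powr (\<gamma> * real (Suc L)) = s powr \<gamma> * s powr (\<gamma> * real L)"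
      by (simp add: powr_add[symmetric] algebra_simps)
    with Suc show ?case by (simp add: algebra_simps)
  qed (use assms in simp)
  also have "\<dots> \<le> s powr \<gamma> * s powr (\<gamma> * real L)" by simp
  finally show ?thesis using q by (simp add: field_simps)
qed

theorem proposition4:
  fixes \<Theta> :: "'a::euclidean_space set"
    and K :: "'a \<Rightarrow> 'a \<Rightarrow> real"
    and \<pi> \<mu>0 :: "'a \<Rightarrow> real"
    and p :: "nat \<Rightarrow> 'a \<Rightarrow> real"
    and \<mu> :: "nat \<Rightarrow> real \<Rightarrow> 'a \<Rightarrow> real"
    and tol c :: "nat \<Rightarrow> real"
    and r :: "real \<Rightarrow> real"
    and s \<gamma> \<alpha> c0 k0 k1 k2 k3 \<epsilon> :: real
  assumes "open \<Theta>"
    and "positive_definite_kernel \<Theta> K"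
    and "prob_density_on \<Theta> \<pi>"
    and "prob_density_on \<Theta> \<mu>0"
    and "\<And>l. 1 \<le> l \<Longrightarrow> prob_density_on \<Theta> (p l)"
    and "\<And>\<theta>. \<theta> \<in> \<Theta> \<Longrightarrow> (\<lambda>l. p l \<theta>) \<longlonglongrightarrow> \<pi> \<theta>"
    and tol: "\<And>l. tol l = sqrt (2 * k1) * s powr (- \<alpha> * real l / 2)"
    and ml: "multilevel_svgd \<Theta> K p tol \<mu>0 \<mu>"
    and i: "1 < s" "0 < c0" "0 < \<gamma>"
      "\<And>l. 1 \<le> l \<Longrightarrow> c l \<le> c0 * s powr (\<gamma> * real l)"
    and ii: "0 < \<alpha>" "0 < k0" "0 < k1"
      "\<And>l. 1 \<le> l \<Longrightarrow> KL \<mu>0 (p l) \<le> ereal k0"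
      "\<And>l. 1 \<le> l \<Longrightarrow> KL (p l) \<pi> \<le> ereal (k1 * s powr (- \<alpha> * real l))"
    and iii: "0 < k2"
      "\<And>l. 2 \<le> l \<Longrightarrow> KL (p (l - 1)) (p l) \<le> ereal (k2 * s powr (- \<alpha> * real l))"
    and iv: "antimono_on {0..} r" "r ` {0..} \<subseteq> {0..1}" "r 0 = 1" "(r \<longlongrightarrow> 0) at_top"
      "\<And>l \<nu> t. 1 \<le> l \<Longrightarrow> svgd_solution \<Theta> K (p l) \<nu> \<Longrightarrow> 0 \<le> t \<Longrightarrow>
         KL (\<nu> t) (p l) \<le> ereal (r t) * KL (\<nu> 0) (p l)"
    and v: "\<And>l. 2 \<le> l \<Longrightarrow> integrable lborel (level_integrand p tol \<mu> l)"
      "\<And>l. 2 \<le> l \<Longrightarrow> level_remainder p tol \<mu> l \<le> k3 * s powr (- \<alpha> * real l)"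
    \<comment> \<open>normalization of the constants: can always be met by enlarging \<open>k2\<close>\<close>
    and k0_bound: "k0 \<le> k1 + (k2 + k3) * s powr (- \<alpha>)"
    and eps: "0 < \<epsilon>" "\<epsilon> \<le> sqrt (2 * k1)"
  defines "L \<equiv> high_fidelity_level p \<pi> tol \<epsilon>"
  shows "1 \<le> L \<and> hellinger (p L) \<pi> \<le> \<epsilon> / 2 \<and> tol L \<le> \<epsilon> \<and>
    hellinger (ml_density p tol \<mu> L) \<pi> \<le> \<epsilon> \<and>
    ml_cost c p tol \<mu> L \<le>
      c0 * s powr (2 * \<gamma>) * (2 * k1) powr (\<gamma> / \<alpha>) / (s powr \<gamma> - 1)
      * rate_inverse r (1 / (s powr \<alpha> + (k2 + k3) / k1)) * \<epsilon> powr (- 2 * \<gamma> / \<alpha>)"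

proof -
  note dens = assms(3,5)
  have sol: "\<And>l. 1 \<le> l \<Longrightarrow> svgd_solution \<Theta> K (p l) (\<mu> l)"
    and \<mu>_init: "\<mu> 1 0 = \<mu>0" "\<And>l. 2 \<le> l \<Longrightarrow> \<mu> l 0 = ml_density p tol \<mu> (l - 1)"
    using ml by (auto simp: multilevel_svgd_def)
  have tol_pos: "0 < tol l" for l using i(1) ii(3) by (simp add: tol)
  \<comment> \<open>With these tolerances the stopping threshold at level \<open>l\<close> equals
    the assumed bound on \<open>KL (p l) \<pi>\<close>, so sampling error and target error are
    balanced.\<close>
  have tol_power2: "(tol l)\<^sup>2 / 2 = k1 * s powr (- \<alpha> * real l)" for l
    using i(1) ii(3) by (simp add: tol power_mult_distrib powr_power)

  have hell: "hellinger (p l) \<pi> \<le> tol l / 2" if "1 \<le> l" for l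
    using ii(5)[OF that] tol_pos[of l]
    by (intro hellinger_le_of_KL[OF dens(2)[OF that] dens(1)]) (auto simp: tol_power2)
  have "tol \<longlonglongrightarrow> 0"
    unfolding tol[abs_def] using i(1) ii(1) by real_asymp
  then have "eventually (\<lambda>l. tol l < \<epsilon> \<and> 1 \<le> l) sequentially"
    using order_tendstoD(2)[of tol 0 sequentially \<epsilon>] eps(1) eventually_ge_at_top[of 1]
    by (auto intro: eventually_conj)
  then obtain l0 where l0: "tol l0 < \<epsilon>" "1 \<le> l0"
    using eventually_happens'[OF sequentially_bot] by blast
  have good: "1 \<le> l \<and> hellinger (p l) \<pi> \<le> \<epsilon> / 2 \<and> tol l \<le> \<epsilon>" if "1 \<le> l" "tol l \<le> \<epsilon>" for l
    using hell[OF that(1)] that by simp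
  have L: "1 \<le> L" "hellinger (p L) \<pi> \<le> \<epsilon> / 2" "tol L \<le> \<epsilon>"
    using LeastI[of "\<lambda>L. 1 \<le> L \<and> hellinger (p L) \<pi> \<le> \<epsilon> / 2 \<and> tol L \<le> \<epsilon>" l0] good[of l0] l0
    by (auto simp: L_def high_fidelity_level_def)
  \<comment> \<open>By minimality of \<open>L\<close>, the level \<open>L - 1\<close> still has too
    large a tolerance. For \<open>L = 1\<close> there is no such level, and the claim is the
    hypothesis \<open>\<epsilon> \<le> sqrt (2 * k1)\<close>, as
    \<open>tol 0 = sqrt (2 * k1)\<close>. This bound later converts \<open>L\<close> into a power of
    \<epsilon>.\<close>
  have eps_le: "\<epsilon> \<le> tol (L - 1)"
  proof (cases "L = 1")
    case True
    then show ?thesis using eps i(1) by (simp add: tol)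
  next
    case False
    show ?thesis
    proof (rule ccontr)
      assume "\<not> \<epsilon> \<le> tol (L - 1)"
      with good[of "L - 1"] False L(1) have "L \<le> L - 1"
        unfolding L_def high_fidelity_level_def by (intro Least_le) auto
      with L(1) show False by simp
    qed
  qed

  \<comment> \<open>The factor \<open>w\<close> solves
    \<open>b (l - 1) + (k2 + k3) * s powr (- \<alpha> * l) = w * b l\<close>: the old threshold plus
    the price of changing the target is \<open>w\<close> times the new threshold.\<close>
  define w where "w = s powr \<alpha> + (k2 + k3) / k1"
  define T where "T = rate_inverse r (1 / w)"
  define b where "b l = k1 * s powr (- \<alpha> * real l)" for l
  have b_pos: "0 < b l" for l using i(1) ii(3) by (simp add: b_def)
  have w_k1: "w * b 1 = k1 + (k2 + k3) * s powr (- \<alpha>)"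
    using i(1) ii(3) by (simp add: w_def b_def field_simps powr_minus)
  \<comment> \<open>No sign is assumed for \<open>k3\<close>, so positivity of \<open>w\<close> is
    drawn from \<open>0 < k0\<close> and \<open>k0_bound\<close>.\<close>
  then have "0 < w * b 1" using k0_bound ii(2) by simp
  then have w: "0 < w" using b_pos[of 1] by (simp add: zero_less_mult_iff)
  have r_nonneg: "0 \<le> r t" if "0 \<le> t" for t using iv(2) that by fastforce
  have T: "0 \<le> T" unfolding T_def using w by (intro rate_inverse_nonneg(2)[OF iv(4)]) simp

  \<comment> \<open>An initial divergence of at most \<open>w * b l\<close> is reduced to
    \<open>b l\<close> by time \<open>T\<close>, by \<open>KL_at_rate_inverse\<close> at
    \<open>1 / w\<close>. So \<open>T\<close> witnesses that the threshold is reached, and it bounds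
    the stopping time at every level.\<close>
  have stop: "0 \<le> ml_stop_time p tol \<mu> l \<and> ml_stop_time p tol \<mu> l \<le> T \<and>
      KL (ml_density p tol \<mu> l) (p l) \<le> ereal (b l)"
    if l: "1 \<le> l" and init: "KL (\<mu> l 0) (p l) \<le> ereal (w * b l)" for l
  proof -
    have "KL (\<mu> l T) (p l) \<le> ereal (b l)"
      unfolding T_def
      by (rule KL_at_rate_inverse[OF sol[OF l] dens(2)[OF l] iv(1,4) _ _ init])
        (use w b_pos[of l] r_nonneg iv(5)[OF l sol[OF l]] in auto)
    then show ?thesis
      using svgd_stop_time[OF sol[OF l] dens(2)[OF l] T, of "tol l"]
      by (simp add: tol_power2 b_def ml_stop_time_def ml_density_def)
  qed
  \<comment> \<open>Induction over levels: \<open>k0_bound\<close> covers level 1. In the step,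
    \<open>stop\<close> controls the output of level \<open>l\<close> relative to
    \<open>p l\<close>, and \<open>KL_le_add\<close> moves it to the next target.\<close>
  have init: "KL (\<mu> l 0) (p l) \<le> ereal (w * b l)" if "1 \<le> l" for l
    using that
  proof (induction l rule: nat_induct_at_least)
    case base
    have "KL \<mu>0 (p 1) \<le> ereal k0" by (rule ii(4)) simp
    also have "\<dots> \<le> ereal (w * b 1)" using w_k1 k0_bound by simp
    finally show ?case using \<mu>_init(1) by simp
  next
    case (Suc l)
    let ?m = "ml_density p tol \<mu> l" and ?s = "s powr (- \<alpha> * real (Suc l))"
    from stop[OF Suc] have st: "0 \<le> ml_stop_time p tol \<mu> l" "KL ?m (p l) \<le> ereal (b l)" by auto
    have m: "prob_density_on \<Theta> ?m"
      unfolding ml_density_def using svgd_solutionD(2)[OF sol] Suc(1) st(1) by simp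
    have "KL ?m (p (Suc l)) \<le> ereal (b l + k2 * ?s + k3 * ?s)"
    proof (rule KL_le_add[OF m dens(2) dens(2) _ _ st(2)])
      show "KL (p l) (p (Suc l)) \<le> ereal (k2 * ?s)"
        using iii(2)[of "Suc l"] Suc(1) by simp
      show "integrable lborel (\<lambda>x. (?m x - p l x) * ln (p l x / p (Suc l) x))"
        "(\<integral>x. (?m x - p l x) * ln (p l x / p (Suc l) x) \<partial>lborel) \<le> k3 * ?s"
        using v[of "Suc l"] Suc(1)
        by (simp_all add: level_integrand_def[abs_def] level_remainder_def)
      show "0 < p l x" "0 < p (Suc l) x" if "x \<in> \<Theta>" for x
        using svgd_solutionD(1)[OF sol that] Suc(1) by auto
    qed (use Suc(1) in auto)
    also have "b l + k2 * ?s + k3 * ?s = w * b (Suc l)"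
    proof -
      have "s powr (- \<alpha> * real l) = s powr \<alpha> * ?s"
        by (simp add: powr_add[symmetric] algebra_simps)
      then show ?thesis
        using ii(3) by (simp add: b_def w_def field_simps)
    qed
    finally show ?case using \<mu>_init(2)[of "Suc l"] Suc(1) by simp
  qed
  note stop = stop[OF _ init]

  \<comment> \<open>The error budget \<epsilon> is halved: one half for stopping at level
    \<open>L\<close>, the other for replacing \<pi> by \<open>p L\<close>.\<close>
  have "hellinger (ml_density p tol \<mu> L) (p L) \<le> tol L / 2"
  proof (rule hellinger_le_of_KL[OF _ dens(2)[OF L(1)]])
    show "prob_density_on \<Theta> (ml_density p tol \<mu> L)"
      unfolding ml_density_def using svgd_solutionD(2)[OF sol[OF L(1)]] stop[OF L(1) L(1)] by simp
    show "KL (ml_density p tol \<mu> L) (p L) \<le> ereal ((tol L)\<^sup>2 / 2)"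
      using stop[OF L(1) L(1)] unfolding tol_power2 b_def by simp
  qed (use tol_pos[of L] in simp)
  then have "hellinger (ml_density p tol \<mu> L) \<pi> \<le> 2 * (\<epsilon> / 2)"
    using L svgd_solutionD(2)[OF sol[OF L(1)]] stop[OF L(1) L(1)] dens(1) dens(2)[OF L(1)]
    by (intro hellinger_le_twice[of \<Theta> _ "p L"]) (auto simp: ml_density_def)
  moreover have "ml_cost c p tol \<mu> L \<le>
      c0 * s powr (2 * \<gamma>) * (2 * k1) powr (\<gamma> / \<alpha>) / (s powr \<gamma> - 1) * T * \<epsilon> powr (- 2 * \<gamma> / \<alpha>)"
  proof -
    have q: "1 < s powr \<gamma>" using i by simp
    \<comment> \<open>The exponent is arranged so that \<open>eps_le\<close>, in the form \<open>s
      powr (\<alpha> * (L - 1) / 2) \<le> sqrt (2 * k1) / \<epsilon>\<close>, can be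
      inserted.\<close>
    have "s powr (\<gamma> * real (L - 1)) = (s powr (\<alpha> * real (L - 1) / 2)) powr (2 * \<gamma> / \<alpha>)"
      using ii(1) by (simp add: powr_powr field_simps)
    also have "\<dots> \<le> (sqrt (2 * k1) / \<epsilon>) powr (2 * \<gamma> / \<alpha>)"
    proof (rule powr_mono2)
      have "tol (L - 1) = sqrt (2 * k1) / s powr (\<alpha> * real (L - 1) / 2)"
        by (simp add: tol powr_minus_divide)
      then show "s powr (\<alpha> * real (L - 1) / 2) \<le> sqrt (2 * k1) / \<epsilon>"
        using mult_right_mono[OF eps_le, of "s powr (\<alpha> * real (L - 1) / 2)"] eps(1) i(1)
        by (simp add: field_simps)
    qed (use ii(1) i(3) in auto)
    also have "\<dots> = (2 * k1) powr (\<gamma> / \<alpha>) * \<epsilon> powr (- 2 * \<gamma> / \<alpha>)"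
      using ii(3) eps(1) by (simp add: powr_divide powr_half_sqrt[symmetric] powr_powr powr_minus_divide)
    \<comment> \<open>Passing from \<open>L - 1\<close> to \<open>L\<close> costs one factor
      \<open>s powr \<gamma>\<close>; the geometric sum contributes another, whence
      \<open>s powr (2 * \<gamma>)\<close> in the final bound.\<close>
    finally have "s powr \<gamma> * s powr (\<gamma> * real (L - 1))
        \<le> s powr \<gamma> * ((2 * k1) powr (\<gamma> / \<alpha>) * \<epsilon> powr (- 2 * \<gamma> / \<alpha>))"
      by (rule mult_left_mono) simp
    moreover have "s powr \<gamma> * s powr (\<gamma> * real (L - 1)) = s powr (\<gamma> * real L)"
      using L(1) by (simp add: powr_add[symmetric] algebra_simps)
    ultimately have sL: "s powr (\<gamma> * real L) \<le> s powr \<gamma> * ((2 * k1) powr (\<gamma> / \<alpha>) * \<epsilon> powr (- 2 * \<gamma> / \<alpha>))"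
      by simp
    have "ml_cost c p tol \<mu> L \<le> (\<Sum>l=1..L. c0 * s powr (\<gamma> * real l) * T)"
      unfolding ml_cost_def
    proof (rule sum_mono)
      fix l assume "l \<in> {1..L}"
      then have l: "1 \<le> l" by simp
      have "c l * ml_stop_time p tol \<mu> l \<le> c0 * s powr (\<gamma> * real l) * ml_stop_time p tol \<mu> l"
        using i(4)[OF l] stop[OF l l] by (intro mult_right_mono) auto
      also have "\<dots> \<le> c0 * s powr (\<gamma> * real l) * T"
        using stop[OF l l] i(2) by (intro mult_left_mono) auto
      finally show "c l * ml_stop_time p tol \<mu> l \<le> c0 * s powr (\<gamma> * real l) * T" .
    qed
    also have "\<dots> = c0 * T * (\<Sum>l=1..L. s powr (\<gamma> * real l))"
      by (simp add: sum_distrib_left mult_ac)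
    also have "\<dots> \<le> c0 * T * (s powr \<gamma> * s powr (\<gamma> * real L) / (s powr \<gamma> - 1))"
      using sum_powr_geometric_le[OF i(1,3), of L] i(2) T by (intro mult_left_mono) auto
    also have "\<dots> \<le> c0 * T * (s powr \<gamma> *
        (s powr \<gamma> * ((2 * k1) powr (\<gamma> / \<alpha>) * \<epsilon> powr (- 2 * \<gamma> / \<alpha>))) / (s powr \<gamma> - 1))"
      using sL i(2) T q by (intro mult_left_mono divide_right_mono) auto
    also have "\<dots> = c0 * (s powr \<gamma> * s powr \<gamma>) * (2 * k1) powr (\<gamma> / \<alpha>) / (s powr \<gamma> - 1) * T * \<epsilon> powr (- 2 * \<gamma> / \<alpha>)"
      by (simp add: mult_ac)
    also have "s powr \<gamma> * s powr \<gamma> = s powr (2 * \<gamma>)"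
      by (simp add: powr_add[symmetric])
    finally show ?thesis .
  qed
  ultimately show ?thesis
    using L by (simp add: T_def w_def)
qed

end
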